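(* Let $\mathcal{U}$ and $\mathcal{A}$ be nonempty finite sets, let $T\ge 1$ be an integer, and let $\beta>1$. For each $t\in\{1,\dots,T\}$ let $a_t>0$ be a real number. For all $\mu\in\mathcal{U}$, $\alpha\in\mathcal{A}$ let $r^1_{\mu,\alpha}>0$ be fixed constants. Consider the function $$F=\sum_{\mu\in\mathcal{U}}\sum_{\alpha\in\mathcal{A}}\sum_{t=1}^{T}\frac{(x^t_{\mu,\alpha})^{a_t}}{\left(r^t_{\mu,\alpha}\,p^t_{\mu,\alpha}\right)^{\beta-1}}$$ of the independent real variables $x^t_{\mu,\alpha}\in[0,1]$ and $p^t_{\mu,\alpha}\in(0,1]$ (for $\mu\in\mathcal{U}$, $\alpha\in\mathcal{A}$, $1\le t\le T$) and $r^t_{\mu,\alpha}\in(0,\infty)$ (for $\mu\in\mathcal{U}$, $\alpha\in\mathcal{A}$, $2\le t\le T$). Then $F$ is jointly convex in all these variables if and only if $$a_1\ge \beta\qquad\text{and}\qquad a_t\ge 2\beta-1\ \text{ for all } t \text{ with } 2\le t\le T .$$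
   Context: In the application, $\mathcal{U}$ is the set of users, $\mathcal{A}$ the set of access points and $t$ indexes future service times. The variable $x^t_{\mu,\alpha}$ is a relaxed assignment variable, $p^t_{\mu,\alpha}$ is a proportion of allocated resources, and $r^t_{\mu,\alpha}$ is a data rate. The function $F$ is the objective of a relaxed minimization problem in which the binary variable $x$ has been replaced by $h(x)=x^a$, $a>0$. For $t=1$ the rate $r^1_{\mu,\alpha}$ is a given constant (determined by the previous assignment), whereas for $t\ge2$ the rate $r^t_{\mu,\alpha}$ is treated as an optimization variable in its own right (its relation to $x^{t-1}_{\mu,\alpha}$ being imposed as a separate constraint, not substituted into $F$). Convexity refers to the function $F$ on the product of the stated intervals. *)

theory Defs
  imports "HOL-Analysis.Analysis" "HOL-Analysis.Finite_Function_Topology"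
begin

(* A finitely supported function whose support lies in the finite set K is a point of R^K; unlike the
   plain function type, poly_mapping is an instance of real_vector, so convex_on applies to it. *)
definition box_on :: "'i set \<Rightarrow> real set \<Rightarrow> ('i \<Rightarrow>\<^sub>0 real) set" where
  "box_on K S = {z. Poly_Mapping.keys z \<subseteq> K \<and> (\<forall>i\<in>K. Poly_Mapping.lookup z i \<in> S)}"

type_synonym ('u, 'a) variable = "('u \<times> 'a \<times> nat) \<Rightarrow>\<^sub>0 real"

(* Points are triples (x, p, r). There is no variable r at t = 1. *)
definition domainF :: "'u set \<Rightarrow> 'a set \<Rightarrow> nat \<Rightarrow>
    (('u, 'a) variable \<times> ('u, 'a) variable \<times> ('u, 'a) variable) set" where
  "domainF U A T =
     box_on (U \<times> A \<times> {1..T}) {0..1} \<times>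
     box_on (U \<times> A \<times> {1..T}) {0<..1} \<times>
     box_on (U \<times> A \<times> {2..T}) {0<..}"

definition rate :: "('u \<Rightarrow> 'a \<Rightarrow> real) \<Rightarrow> ('u, 'a) variable \<Rightarrow> 'u \<Rightarrow> 'a \<Rightarrow> nat \<Rightarrow> real" where
  "rate r1 r \<mu> \<alpha> t = (if t = 1 then r1 \<mu> \<alpha> else Poly_Mapping.lookup r (\<mu>, \<alpha>, t))"

(* On domainF the bases of powr are nonnegative, and 0 powr c = 0 agrees with 0^c as c > 0. *)
definition objF :: "'u set \<Rightarrow> 'a set \<Rightarrow> nat \<Rightarrow> real \<Rightarrow> (nat \<Rightarrow> real) \<Rightarrow> ('u \<Rightarrow> 'a \<Rightarrow> real) \<Rightarrow>
    ('u, 'a) variable \<times> ('u, 'a) variable \<times> ('u, 'a) variable \<Rightarrow> real" where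
  "objF U A T \<beta> a r1 = (\<lambda>(x, p, r). \<Sum>\<mu>\<in>U. \<Sum>\<alpha>\<in>A. \<Sum>t=1..T.
     Poly_Mapping.lookup x (\<mu>, \<alpha>, t) powr a t /
     (rate r1 r \<mu> \<alpha> t * Poly_Mapping.lookup p (\<mu>, \<alpha>, t)) powr (\<beta> - 1))"

end

theory Submission
  imports Defs
begin

text \<open>
  The monomial $x^a p^{-b} r^{-c}$ with $a \ge 1 + b + c$ lies above each of its tangent planes: after
  rescaling the base point to $(1,1,1)$ this is the weighted AM-GM inequality with weights
  $1, b, c, a - 1 - b - c$, so the monomial is convex. Conversely, let a single $x$ be nonzero and
  take the midpoint of the points with $(x,p,r) = (1,1,1)$ and $(x,p,r) = (0,\varepsilon,\varepsilon)$.
  As $\varepsilon \to 0$, convexity gives $2^{-(a-b-c)} \le 1/2$, which is $a \ge 1 + b + c$. The case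
  $t = 1$ is $b = \beta - 1$, $c = 0$, and the case $t \ge 2$ is $b = c = \beta - 1$.
\<close>

section \<open>Tangent planes and convexity of the monomial\<close>

lemma weighted_am_gm_monomial:
  fixes u v w a b c :: real
  assumes u: "u \<ge> 0" and v: "v > 0" and w: "w > 0"
    and b: "b \<ge> 0" and c: "c \<ge> 0" and abc: "a \<ge> 1 + b + c"
  shows "a * u \<le> u powr a / (v powr b * w powr c) + b * v + c * w + (a - 1 - b - c)"
proof (cases "u = 0")
  case True
  then show ?thesis using assms by simp
next
  case False
  with u have u: "u > 0" by simp
  \<comment> \<open>The tangent line of exp at ln u bounds exp (ln y) = y from below. The bound is
    affine in ln y, so weighted sums of such bounds act on logarithms.\<close>
  have log_le: "y \<ge> u * (1 + ln y - ln u)" if "y > 0" for y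
    using ln_le_minus_one[of "y / u"] that u by (simp add: ln_div field_simps)
  \<comment> \<open>The weights 1, b, c, a - 1 - b - c have total a, and ln m + b ln v + c ln w = a
    ln u. Hence the logarithms cancel in the weighted sum of the four bounds, which leaves a
    u.\<close>
  define m where "m = u powr a / (v powr b * w powr c)"
  have m: "m > 0" using u v w by (simp add: m_def)
  have ln_m: "ln m = a * ln u - b * ln v - c * ln w"
    using u v w by (simp add: m_def ln_div ln_mult ln_powr)
  have "m + b * v + c * w + (a - 1 - b - c) * 1 \<ge>
      u * (1 + ln m - ln u) + b * (u * (1 + ln v - ln u)) + c * (u * (1 + ln w - ln u))
        + (a - 1 - b - c) * (u * (1 + ln 1 - ln u))"
    using m v w b c abc by (intro add_mono mult_left_mono log_le) auto
  also have "u * (1 + ln m - ln u) + b * (u * (1 + ln v - ln u)) + c * (u * (1 + ln w - ln u))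
        + (a - 1 - b - c) * (u * (1 + ln 1 - ln u)) = a * u"
    by (simp add: ln_m algebra_simps)
  finally show ?thesis by (simp add: m_def)
qed

lemma monomial_ge_tangent:
  fixes x p r x0 p0 r0 a b c :: real
  assumes "x \<ge> 0" "p > 0" "r > 0" "x0 \<ge> 0" "p0 > 0" "r0 > 0"
    and "b \<ge> 0" "c \<ge> 0" "a \<ge> 1 + b + c"
  shows "x0 powr a / (p0 powr b * r0 powr c) *
      (1 + a * (x / x0 - 1) - b * (p / p0 - 1) - c * (r / r0 - 1))
    \<le> x powr a / (p powr b * r powr c)"
proof (cases "x0 = 0")
  \<comment> \<open>The quotient \<open>x / x0\<close> has only its default value here, but the
    prefactor contains \<open>0 powr a = 0\<close>, so the claim reduces to nonnegativity of the
    right side.\<close>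
  case True
  then show ?thesis by simp
next
  case False
  have "1 + a * (x / x0 - 1) - b * (p / p0 - 1) - c * (r / r0 - 1)
      \<le> (x / x0) powr a / ((p / p0) powr b * (r / r0) powr c)"
    using weighted_am_gm_monomial[of "x / x0" "p / p0" "r / r0" b c a] assms
    by (simp add: algebra_simps)
  then have "x0 powr a / (p0 powr b * r0 powr c) *
      (1 + a * (x / x0 - 1) - b * (p / p0 - 1) - c * (r / r0 - 1))
      \<le> x0 powr a / (p0 powr b * r0 powr c) *
        ((x / x0) powr a / ((p / p0) powr b * (r / r0) powr c))"
    by (intro mult_left_mono) auto
  also have "\<dots> = x powr a / (p powr b * r powr c)"
    using False assms by (simp add: powr_divide)
  finally show ?thesis .
qed

text \<open>The tangent plane at the convex combination \<open>q\<close> lies below the function at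
  both end points, and the weighted mean of its values there is its value at \<open>q\<close>, where
  it touches the function.\<close>

lemma convex_on_monomial:
  fixes a b c :: real
  assumes "b \<ge> 0" "c \<ge> 0" "a \<ge> 1 + b + c"
  shows "convex_on ({0..} \<times> {0<..} \<times> {0<..}) (\<lambda>(x, p, r). x powr a / (p powr b * r powr c))"
    (is "convex_on ?S ?f")
proof (rule convex_onI)
  show conv: "convex ?S"
    by (intro convex_Times) auto
  fix s :: real and y z :: "real \<times> real \<times> real"
  assume s: "0 < s" "s < 1" and y: "y \<in> ?S" and z: "z \<in> ?S"
  define q where "q = (1 - s) *\<^sub>R y + s *\<^sub>R z"
  obtain x1 p1 r1 where y': "y = (x1, p1, r1)" by (cases y)
  obtain x2 p2 r2 where z': "z = (x2, p2, r2)" by (cases z)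
  obtain x0 p0 r0 where q': "q = (x0, p0, r0)" by (cases q)
  have "q \<in> ?S"
    unfolding q_def using conv y z s by (intro convexD) auto
  then have q0: "x0 \<ge> 0" "p0 > 0" "r0 > 0" by (auto simp: q')
  have comb: "x0 = (1 - s) * x1 + s * x2" "p0 = (1 - s) * p1 + s * p2"
      "r0 = (1 - s) * r1 + s * r2"
    using q' by (auto simp: q_def y' z')
  \<comment> \<open>The left sides stay \<open>x0 / x0\<close> rather than 1, so the identities also
    hold on the face x0 = 0, where every quotient is 0.\<close>
  have ratio: "x0 / x0 = (1 - s) * (x1 / x0) + s * (x2 / x0)"
      "p0 / p0 = (1 - s) * (p1 / p0) + s * (p2 / p0)"
      "r0 / r0 = (1 - s) * (r1 / r0) + s * (r2 / r0)"
    by (simp_all only: comb add_divide_distrib times_divide_eq_right)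
  define m where "m = ?f q"
  define h where "h x p r = m * (1 + a * (x / x0 - 1) - b * (p / p0 - 1) - c * (r / r0 - 1))"
    for x p r
  have h1: "h x1 p1 r1 \<le> ?f y" and h2: "h x2 p2 r2 \<le> ?f z"
    using y z q0 assms monomial_ge_tangent by (auto simp: h_def m_def y' z' q')
  \<comment> \<open>For x0 = 0 the value \<open>m\<close> is 0 and both sides vanish; otherwise all
    three quotients equal 1.\<close>
  have "?f q = h x0 p0 r0"
    using q0 by (cases "x0 = 0") (auto simp: h_def m_def q')
  also have "\<dots> = (1 - s) * h x1 p1 r1 + s * h x2 p2 r2"
    unfolding h_def ratio by algebra
  also have "\<dots> \<le> (1 - s) * ?f y + s * ?f z"
    using s h1 h2 by (intro add_mono mult_left_mono) auto
  finally show "?f ((1 - s) *\<^sub>R y + s *\<^sub>R z) \<le> (1 - s) * ?f y + s * ?f z"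
    by (simp add: q_def)
qed

section \<open>Operations that preserve convexity\<close>

lemma convex_on_linear_comp:
  assumes f: "convex_on S f" and T: "convex T" and g: "\<And>x. x \<in> T \<Longrightarrow> g x \<in> S"
    and affine: "\<And>s x y. g ((1 - s) *\<^sub>R x + s *\<^sub>R y) = (1 - s) *\<^sub>R g x + s *\<^sub>R g y"
  shows "convex_on T (\<lambda>x. f (g x))"
  using T by (intro convex_onI) (auto simp: affine intro!: convex_onD[OF f] g)

lemma convex_on_cong:
  assumes "convex_on S f" and "\<And>x. x \<in> S \<Longrightarrow> f x = g x"
  shows "convex_on S g"
  using assms by (auto simp: convex_on_def convexD)

lemma convex_on_sum_fun:
  assumes "convex S" and "\<And>i. i \<in> I \<Longrightarrow> convex_on S (f i)"
  shows "convex_on S (\<lambda>x. \<Sum>i\<in>I. f i x)"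
proof (rule convex_onI[OF _ assms(1)])
  fix s x y assume s: "0 < (s::real)" "s < 1" and xy: "x \<in> S" "y \<in> S"
  have "(\<Sum>i\<in>I. f i ((1 - s) *\<^sub>R x + s *\<^sub>R y)) \<le> (\<Sum>i\<in>I. (1 - s) * f i x + s * f i y)"
    using assms(2) s xy by (intro sum_mono convex_onD) auto
  then show "(\<Sum>i\<in>I. f i ((1 - s) *\<^sub>R x + s *\<^sub>R y))
      \<le> (1 - s) * (\<Sum>i\<in>I. f i x) + s * (\<Sum>i\<in>I. f i y)"
    by (simp add: sum.distrib sum_distrib_left)
qed

section \<open>Boxes of finitely supported functions\<close>

lemma lookup_scaleR: "Poly_Mapping.lookup (c *\<^sub>R f) i = c *\<^sub>R Poly_Mapping.lookup f i"
proof -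
  have "finite {i. c *\<^sub>R Poly_Mapping.lookup f i \<noteq> 0}"
    by (rule finite_subset[OF _ finite_lookup[of f]]) auto
  then show ?thesis
    by (simp add: scaleR_poly_mapping_def)
qed

lemma convex_box_on:
  assumes "convex S"
  shows "convex (box_on K S)"
proof (rule convexI)
  fix x y and s t :: real
  assume xy: "x \<in> box_on K S" "y \<in> box_on K S" and st: "0 \<le> s" "0 \<le> t" "s + t = 1"
  have "Poly_Mapping.keys (s *\<^sub>R x + t *\<^sub>R y) \<subseteq> K"
  proof
    fix i assume "i \<in> Poly_Mapping.keys (s *\<^sub>R x + t *\<^sub>R y)"
    then have "i \<in> Poly_Mapping.keys x \<or> i \<in> Poly_Mapping.keys y"
      by (auto simp: in_keys_iff lookup_add lookup_scaleR)
    with xy show "i \<in> K"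
      by (auto simp: box_on_def)
  qed
  moreover have "Poly_Mapping.lookup (s *\<^sub>R x + t *\<^sub>R y) i \<in> S" if "i \<in> K" for i
    using convexD[OF assms, of "Poly_Mapping.lookup x i" "Poly_Mapping.lookup y i" s t] that xy st
    by (simp add: box_on_def lookup_add lookup_scaleR)
  ultimately show "s *\<^sub>R x + t *\<^sub>R y \<in> box_on K S"
    by (simp add: box_on_def)
qed

lemma convex_domainF: "convex (domainF U A T)"
  unfolding domainF_def by (intro convex_Times convex_box_on) auto

section \<open>Sufficiency: the summands of F\<close>

definition termF :: "real \<Rightarrow> (nat \<Rightarrow> real) \<Rightarrow> ('u \<Rightarrow> 'a \<Rightarrow> real) \<Rightarrow> 'u \<Rightarrow> 'a \<Rightarrow> nat \<Rightarrow>
    ('u, 'a) variable \<times> ('u, 'a) variable \<times> ('u, 'a) variable \<Rightarrow> real" where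
  "termF \<beta> a r1 \<mu> \<alpha> t = (\<lambda>(x, p, r). Poly_Mapping.lookup x (\<mu>, \<alpha>, t) powr a t /
     (rate r1 r \<mu> \<alpha> t * Poly_Mapping.lookup p (\<mu>, \<alpha>, t)) powr (\<beta> - 1))"

lemma objF_eq_sum_termF:
  "objF U A T \<beta> a r1 = (\<lambda>z. \<Sum>\<mu>\<in>U. \<Sum>\<alpha>\<in>A. \<Sum>t=1..T. termF \<beta> a r1 \<mu> \<alpha> t z)"
  by (auto simp: objF_def termF_def)

lemma convex_on_termF_1:
  assumes k: "\<mu> \<in> U" "\<alpha> \<in> A" and "T \<ge> 1" "\<beta> > 1" "r1 \<mu> \<alpha> > 0" "a 1 \<ge> \<beta>"
  shows "convex_on (domainF U A T) (termF \<beta> a r1 \<mu> \<alpha> 1)"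
proof -
  \<comment> \<open>The rate at t = 1 is a constant, so it is absorbed into the second coordinate,
    and the third is frozen at 1 with exponent 0. This map is affine but not linear.\<close>
  define g :: "('a, 'b) variable \<times> ('a, 'b) variable \<times> ('a, 'b) variable \<Rightarrow> real \<times> real \<times> real"
    where "g = (\<lambda>(x, p, r). (Poly_Mapping.lookup x (\<mu>, \<alpha>, 1),
      r1 \<mu> \<alpha> * Poly_Mapping.lookup p (\<mu>, \<alpha>, 1), 1))"
  have "convex_on (domainF U A T)
      (\<lambda>z. (\<lambda>(x, p, r). x powr a 1 / (p powr (\<beta> - 1) * r powr 0)) (g z))"
    by (rule convex_on_linear_comp[OF convex_on_monomial convex_domainF])
      (use assms in \<open>auto simp: g_def domainF_def box_on_def lookup_add lookup_scaleR
        distrib_left mult.left_commute\<close>)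
  also have "(\<lambda>z. (\<lambda>(x, p, r). x powr a 1 / (p powr (\<beta> - 1) * r powr 0)) (g z))
      = termF \<beta> a r1 \<mu> \<alpha> 1"
    by (auto simp: termF_def g_def rate_def)
  finally show ?thesis .
qed

lemma convex_on_termF_ge_2:
  assumes k: "\<mu> \<in> U" "\<alpha> \<in> A" "t \<in> {2..T}" and "\<beta> > 1" "a t \<ge> 2 * \<beta> - 1"
  shows "convex_on (domainF U A T) (termF \<beta> a r1 \<mu> \<alpha> t)"
proof -
  define g :: "('a, 'b) variable \<times> ('a, 'b) variable \<times> ('a, 'b) variable \<Rightarrow> real \<times> real \<times> real"
    where "g = (\<lambda>(x, p, r). (Poly_Mapping.lookup x (\<mu>, \<alpha>, t),
      Poly_Mapping.lookup p (\<mu>, \<alpha>, t), Poly_Mapping.lookup r (\<mu>, \<alpha>, t)))"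
  have "convex_on (domainF U A T)
      (\<lambda>z. (\<lambda>(x, p, r). x powr a t / (p powr (\<beta> - 1) * r powr (\<beta> - 1))) (g z))"
    by (rule convex_on_linear_comp[OF convex_on_monomial convex_domainF])
      (use assms in \<open>auto simp: g_def domainF_def box_on_def lookup_add lookup_scaleR\<close>)
  then show ?thesis
  proof (rule convex_on_cong)
    fix z assume "z \<in> domainF U A T"
    then show "(\<lambda>(x, p, r). x powr a t / (p powr (\<beta> - 1) * r powr (\<beta> - 1))) (g z)
        = termF \<beta> a r1 \<mu> \<alpha> t z"
      using k by (auto simp: g_def termF_def rate_def domainF_def box_on_def powr_mult mult.commute)
  qed
qed

section \<open>Necessity: test points and the limit\<close>

definition const_on :: "'i set \<Rightarrow> real \<Rightarrow> 'i \<Rightarrow>\<^sub>0 real" where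
  "const_on K c = (\<Sum>i\<in>K. Poly_Mapping.single i c)"

lemma lookup_const_on:
  assumes "finite K"
  shows "Poly_Mapping.lookup (const_on K c) i = (if i \<in> K then c else 0)"
  using assms by (simp add: const_on_def lookup_sum lookup_single when_def)

lemma const_on_in_box_on:
  assumes "finite K" "c \<in> S"
  shows "const_on K c \<in> box_on K S"
  using assms by (auto simp: box_on_def lookup_const_on in_keys_iff split: if_splits)

text \<open>Every other summand has numerator \<open>0 powr a t' = 0\<close>, whatever its
  denominator is.\<close>

lemma objF_support_single:
  assumes "finite U" "finite A" "\<mu> \<in> U" "\<alpha> \<in> A" "t \<in> {1..T}"
    and zero: "\<And>i. i \<noteq> (\<mu>, \<alpha>, t) \<Longrightarrow> Poly_Mapping.lookup x i = 0"
  shows "objF U A T \<beta> a r1 (x, p, r) = termF \<beta> a r1 \<mu> \<alpha> t (x, p, r)"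
proof -
  have "objF U A T \<beta> a r1 (x, p, r) =
      (\<Sum>(\<mu>', \<alpha>', t')\<in>U \<times> A \<times> {1..T}. termF \<beta> a r1 \<mu>' \<alpha>' t' (x, p, r))"
    by (simp add: objF_eq_sum_termF sum.cartesian_product)
  also have "\<dots> = (\<Sum>(\<mu>', \<alpha>', t')\<in>{(\<mu>, \<alpha>, t)}. termF \<beta> a r1 \<mu>' \<alpha>' t' (x, p, r))"
    using assms(1-5) by (intro sum.mono_neutral_right) (use zero in \<open>fastforce simp: termF_def\<close>)+
  finally show ?thesis by simp
qed

lemma exponent_bound_of_half_powr:
  fixes a b :: real
  assumes "\<And>\<epsilon>. 0 < \<epsilon> \<Longrightarrow> \<epsilon> \<le> 1 \<Longrightarrow> (1/2) powr a / ((1 + \<epsilon>) / 2) powr b \<le> 1/2"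
  shows "a \<ge> b + 1"
proof -
  \<comment> \<open>Convexity cannot be used at \<epsilon> = 0, which lies outside the domain of p
    and r. The midpoint value still extends continuously there, since its denominator tends to a
    power of 1/2.\<close>
  have "((\<lambda>\<epsilon>::real. (1/2) powr a / ((1 + \<epsilon>) / 2) powr b) \<longlongrightarrow> (1/2) powr a / ((1 + 0) / 2) powr b)
      (at_right 0)"
    by (intro tendsto_intros) auto
  moreover have "\<forall>\<^sub>F \<epsilon>::real in at_right 0. (1/2) powr a / ((1 + \<epsilon>) / 2) powr b \<le> 1/2"
    unfolding eventually_at_right_field using assms by (intro exI[of _ 1]) auto
  ultimately have "(1/2) powr a / ((1 + 0) / 2) powr b \<le> (1/2 :: real)"
    by (intro tendsto_upperbound) auto
  then have "(1/2 :: real) powr (a - b) \<le> (1/2) powr 1"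
    by (simp add: powr_diff)
  \<comment> \<open>The base 1/2 is below 1, so comparing exponents reverses the inequality.\<close>
  then show ?thesis
    using powr_less_mono'[of "1/2" "a - b" 1] by fastforce
qed

lemma termF_midpoint_le:
  fixes U :: "'u set" and A :: "'a set"
  assumes conv: "convex_on (domainF U A T) (objF U A T \<beta> a r1)"
    and fin: "finite U" "finite A" and k: "\<mu> \<in> U" "\<alpha> \<in> A" "t \<in> {1..T}"
    and \<epsilon>: "0 < \<epsilon>" "\<epsilon> \<le> 1"
  shows "(1/2) powr a t / ((if t = 1 then r1 \<mu> \<alpha> else (1 + \<epsilon>) / 2) * ((1 + \<epsilon>) / 2)) powr (\<beta> - 1)
    \<le> 1/2 * (1 / (if t = 1 then r1 \<mu> \<alpha> else 1) powr (\<beta> - 1))"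
proof -
  let ?k = "(\<mu>, \<alpha>, t)" and ?K = "U \<times> A \<times> {1..T}" and ?K2 = "U \<times> A \<times> {2..T}"
  let ?F = "objF U A T \<beta> a r1" and ?G = "termF \<beta> a r1 \<mu> \<alpha> t"
  \<comment> \<open>Only x may be concentrated at one index: p and r must be positive on their whole
    index sets, hence \<open>const_on\<close>. The point \<open>?z\<close> has x = 0 and contributes
    nothing, so the right side is half the value at \<open>?y\<close>.\<close>
  let ?y = "(Poly_Mapping.single ?k 1, const_on ?K 1, const_on ?K2 1)
      :: ('u, 'a) variable \<times> ('u, 'a) variable \<times> ('u, 'a) variable"
  let ?z = "(0, const_on ?K \<epsilon>, const_on ?K2 \<epsilon>)
      :: ('u, 'a) variable \<times> ('u, 'a) variable \<times> ('u, 'a) variable"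
  have y: "?y \<in> domainF U A T"
    using fin k unfolding domainF_def
    by (intro SigmaI const_on_in_box_on) (auto simp: box_on_def lookup_single when_def)
  have z: "?z \<in> domainF U A T"
    using fin \<epsilon> unfolding domainF_def
    by (intro SigmaI const_on_in_box_on) (auto simp: box_on_def)
  have "?F ((1 - 1/2) *\<^sub>R ?y + (1/2) *\<^sub>R ?z) \<le> (1 - 1/2) * ?F ?y + 1/2 * ?F ?z"
    by (rule convex_onD[OF conv _ _ y z]) auto
  moreover have "?F ((1 - 1/2) *\<^sub>R ?y + (1/2) *\<^sub>R ?z) = ?G ((1 - 1/2) *\<^sub>R ?y + (1/2) *\<^sub>R ?z)"
    unfolding scaleR_Pair add_Pair using fin k
    by (intro objF_support_single) (auto simp: lookup_add lookup_scaleR lookup_single when_def)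
  moreover have "?F ?y = ?G ?y" "?F ?z = ?G ?z"
    using fin k by (auto intro!: objF_support_single simp: lookup_single when_def split: if_splits)
  moreover have "?k \<in> ?K" "t \<noteq> 1 \<Longrightarrow> ?k \<in> ?K2"
    using k by auto
  ultimately show ?thesis
    using fin k by (auto simp: termF_def rate_def lookup_add lookup_scaleR lookup_single
        lookup_const_on add_divide_distrib)
qed

theorem lemma1:
  fixes U :: "'u set" and A :: "'a set" and T :: nat and \<beta> :: real
    and a :: "nat \<Rightarrow> real" and r1 :: "'u \<Rightarrow> 'a \<Rightarrow> real"
  assumes "finite U" and "U \<noteq> {}" and "finite A" and "A \<noteq> {}"
    and "T \<ge> 1" and "\<beta> > 1"
    and "\<And>t. t \<in> {1..T} \<Longrightarrow> a t > 0"
    and "\<And>\<mu> \<alpha>. \<mu> \<in> U \<Longrightarrow> \<alpha> \<in> A \<Longrightarrow> r1 \<mu> \<alpha> > 0"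
  shows "convex_on (domainF U A T) (objF U A T \<beta> a r1) \<longleftrightarrow>
    a 1 \<ge> \<beta> \<and> (\<forall>t\<in>{2..T}. a t \<ge> 2 * \<beta> - 1)"
proof
  assume conv: "convex_on (domainF U A T) (objF U A T \<beta> a r1)"
  obtain \<mu> \<alpha> where k: "\<mu> \<in> U" "\<alpha> \<in> A" using assms(2,4) by blast
  note mid = termF_midpoint_le[OF conv assms(1,3) k]
  have r1: "r1 \<mu> \<alpha> > 0" using assms(8) k by blast
  have "a 1 \<ge> (\<beta> - 1) + 1"
  proof (rule exponent_bound_of_half_powr)
    fix \<epsilon> :: real assume \<epsilon>: "0 < \<epsilon>" "\<epsilon> \<le> 1"
    \<comment> \<open>The factor \<open>r1 \<mu> \<alpha> powr (\<beta> - 1)\<close> occurs on both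
      sides of the midpoint inequality and cancels.\<close>
    have "(r1 \<mu> \<alpha> * ((1 + \<epsilon>) / 2)) powr (\<beta> - 1)
        = r1 \<mu> \<alpha> powr (\<beta> - 1) * ((1 + \<epsilon>) / 2) powr (\<beta> - 1)"
      by (rule powr_mult)
    then show "(1/2) powr a 1 / ((1 + \<epsilon>) / 2) powr (\<beta> - 1) \<le> 1/2"
      using mid[of 1 \<epsilon>] \<epsilon> r1 assms(5) by (simp add: divide_le_eq pos_le_divide_eq)
  qed
  moreover have "a t \<ge> 2 * (\<beta> - 1) + 1" if "t \<in> {2..T}" for t
  proof (rule exponent_bound_of_half_powr)
    fix \<epsilon> :: real assume \<epsilon>: "0 < \<epsilon>" "\<epsilon> \<le> 1"
    \<comment> \<open>Both r and p equal (1 + \<epsilon>) / 2 at the midpoint, which doubles the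
      exponent.\<close>
    have "((1 + \<epsilon>) / 2 * ((1 + \<epsilon>) / 2)) powr (\<beta> - 1) = ((1 + \<epsilon>) / 2) powr (2 * (\<beta> - 1))"
      by (subst powr_mult) (simp flip: powr_add)
    then show "(1/2) powr a t / ((1 + \<epsilon>) / 2) powr (2 * (\<beta> - 1)) \<le> 1/2"
      using mid[of t \<epsilon>] \<epsilon> that by (simp split: if_splits)
  qed
  ultimately show "a 1 \<ge> \<beta> \<and> (\<forall>t\<in>{2..T}. a t \<ge> 2 * \<beta> - 1)"
    by (force simp: algebra_simps)
next
  assume a: "a 1 \<ge> \<beta> \<and> (\<forall>t\<in>{2..T}. a t \<ge> 2 * \<beta> - 1)"
  have convex_term: "convex_on (domainF U A T) (termF \<beta> a r1 \<mu> \<alpha> t)"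
    if "\<mu> \<in> U" "\<alpha> \<in> A" "t \<in> {1..T}" for \<mu> \<alpha> t
  proof (cases "t = 1")
    case True
    then show ?thesis
      using convex_on_termF_1[of \<mu> U \<alpha> A T \<beta> r1 a] that a assms(5,6,8) by simp
  next
    case False
    with that have t: "t \<in> {2..T}" by auto
    with a have "a t \<ge> 2 * \<beta> - 1" by simp
    with t show ?thesis
      using convex_on_termF_ge_2[of \<mu> U \<alpha> A t T \<beta> a r1] that(1,2) assms(6) by simp
  qed
  show "convex_on (domainF U A T) (objF U A T \<beta> a r1)"
    unfolding objF_eq_sum_termF
    by (rule convex_on_sum_fun[OF convex_domainF])+ (rule convex_term)
qed

end
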